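(* Let $\psi$ be a score function satisfying (i)–(iv) of the context with constants $\beta,\gamma>0$, let $X_1,\dots,X_n$ be an adversarially corrupted sample of $X_1',\dots,X_n'$ i.i.d. $\sim P$ with outlier index set $\mathcal O$, and suppose that for $X\sim P$, $\mathbb{E}[\rho(\|X-\mathbb{E}[X]\|)]<\min\left(\rho(\beta/3),\psi(\beta/2)^2/2\right)$. If moreover $|\mathcal O|\le n\gamma/8$, then for all $\lambda\in(0,\beta/2)$ and for all $\theta\in\mathcal H$ such that $V_\theta:=\mathbb{E}_{X'\sim P}[\psi(\|X'-\theta\|)^2]\le \psi(\beta/2)^2/2<\infty$, $$t_T(\lambda;\theta,X_1^n)\le t_{\mathrm{IF}}\left(\lambda\gamma/4;\theta,X_1^n\right)+e^{-n\gamma^2/32}.$$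
   Context: $\mathcal H$ is a real Hilbert space with norm $\|\cdot\|$ coming from its scalar product. Score function: $\psi:\mathbb{R}_+\to\mathbb{R}_+$ satisfies (i) $\psi$ is continuous and differentiable almost everywhere; (ii) $\psi(0)=0$; (iii) $\psi$ is concave; (iv) there are $\beta,\gamma>0$ with $1\ge\psi'(x)\ge\gamma\mathbf{1}\{x\le\beta\}$ for all $x\ge 0$. Put $\rho(x)=\int_0^x\psi(t)\,dt$. Adversarial corruption: $X_1',\dots,X_n'$ are i.i.d. with law $P$ on $\mathcal H$; an adversary, who may look at the whole sample, modifies at most $|\mathcal O|$ of the points to produce $X_1,\dots,X_n$; thus there is a partition $\mathcal I\cup\mathcal O=\{1,\dots,n\}$ with $|\mathcal O|<|\mathcal I|$, $X_i=X_i'$ for $i\in\mathcal I$, and $(X_i)_{i\in\mathcal O}$ arbitrary. The M-estimator $T(X_1^n)$ is the solution (assumed to be well defined) of $\sum_{i=1}^n\frac{X_i-T(X_1^n)}{\|X_i-T(X_1^n)\|}\psi(\|X_i-T(X_1^n)\|)=0$. Convention: $\frac{x-\theta}{\|x-\theta\|}\psi(\|x-\theta\|)=0$ when $x=\theta$. Tail functions: $t_T(\lambda;\theta,X_1^n)=\mathbb{P}(\|T(X_1^n)-\theta\|\ge\lambda)$ and $t_{\mathrm{IF}}(\lambda;\theta,X_1^n)=\mathbb{P}\left(\left\|\frac1n\sum_{i=1}^n\frac{X_i-\theta}{\|X_i-\theta\|}\psi(\|X_i-\theta\|)\right\|\ge\lambda\right)$. *)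

theory Defs
  imports "HOL-Probability.Probability"
begin

text \<open>
  A score function is a map on the half line, encoded as a total function on the reals of which only
  the values on \<open>{0..}\<close> matter; derivatives are therefore taken within \<open>{0..}\<close>.  Since it is only
  differentiable almost everywhere, the bounds on its derivative are required exactly at the points
  where the derivative exists (for Huber's score \<open>min x \<beta>\<close> it does not exist at \<open>\<beta>\<close>).
\<close>

definition score_function :: "(real \<Rightarrow> real) \<Rightarrow> real \<Rightarrow> real \<Rightarrow> bool" where
  "score_function \<psi> \<beta> \<gamma> \<longleftrightarrow>
     (\<forall>x\<ge>0. 0 \<le> \<psi> x) \<and>
     continuous_on {0..} \<psi> \<and>
     (AE x in lborel. 0 \<le> x \<longrightarrow> \<psi> differentiable (at x within {0..})) \<and>
     \<psi> 0 = 0 \<and>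
     concave_on {0..} \<psi> \<and>
     0 < \<beta> \<and> 0 < \<gamma> \<and>
     (\<forall>x\<ge>0. \<forall>D. (\<psi> has_real_derivative D) (at x within {0..}) \<longrightarrow>
        \<gamma> * indicator {..\<beta>} x \<le> D \<and> D \<le> 1)"

definition rho :: "(real \<Rightarrow> real) \<Rightarrow> real \<Rightarrow> real" where
  "rho \<psi> x = integral {0..x} \<psi>"

text \<open>As \<open>sgn 0 = 0\<close> and \<open>sgn v = v /\<^sub>R norm v\<close> otherwise, the convention at \<open>x = \<theta>\<close> is built in.\<close>

definition score_vector :: "(real \<Rightarrow> real) \<Rightarrow> 'a::real_inner \<Rightarrow> 'a \<Rightarrow> 'a" where
  "score_vector \<psi> x \<theta> = \<psi> (norm (x - \<theta>)) *\<^sub>R sgn (x - \<theta>)"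

definition M_equation :: "(real \<Rightarrow> real) \<Rightarrow> nat \<Rightarrow> (nat \<Rightarrow> 'a::real_inner) \<Rightarrow> 'a \<Rightarrow> bool" where
  "M_equation \<psi> n x \<theta> \<longleftrightarrow> (\<Sum>i=1..n. score_vector \<psi> (x i) \<theta>) = 0"

definition M_estimator :: "(real \<Rightarrow> real) \<Rightarrow> nat \<Rightarrow> (nat \<Rightarrow> 'a::real_inner) \<Rightarrow> 'a" where
  "M_estimator \<psi> n x = (THE \<theta>. M_equation \<psi> n x \<theta>)"

definition empirical_IF :: "(real \<Rightarrow> real) \<Rightarrow> nat \<Rightarrow> 'a::real_inner \<Rightarrow> (nat \<Rightarrow> 'a) \<Rightarrow> 'a" where
  "empirical_IF \<psi> n \<theta> x = (1 / real n) *\<^sub>R (\<Sum>i=1..n. score_vector \<psi> (x i) \<theta>)"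

definition tail_T ::
  "'w measure \<Rightarrow> (real \<Rightarrow> real) \<Rightarrow> nat \<Rightarrow> (nat \<Rightarrow> 'w \<Rightarrow> 'a::real_inner) \<Rightarrow> 'a \<Rightarrow> real \<Rightarrow> real" where
  "tail_T M \<psi> n X \<theta> r =
     measure M {\<omega> \<in> space M. norm (M_estimator \<psi> n (\<lambda>i. X i \<omega>) - \<theta>) \<ge> r}"

definition tail_IF ::
  "'w measure \<Rightarrow> (real \<Rightarrow> real) \<Rightarrow> nat \<Rightarrow> (nat \<Rightarrow> 'w \<Rightarrow> 'a::real_inner) \<Rightarrow> 'a \<Rightarrow> real \<Rightarrow> real" where
  "tail_IF M \<psi> n X \<theta> r =
     measure M {\<omega> \<in> space M. norm (empirical_IF \<psi> n \<theta> (\<lambda>i. X i \<omega>)) \<ge> r}"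

text \<open>
  The estimator is well defined: almost surely the estimating equation of the observed sample has
  exactly one solution, and that solution is a random variable.  The empirical influence function is
  also required to be a random variable; this only matters in a non-separable Hilbert space, where
  sums of Borel random vectors may fail to be measurable (see \<open>empirical_IF_measurable\<close> below).
\<close>

definition M_estimator_well_defined ::
  "'w measure \<Rightarrow> (real \<Rightarrow> real) \<Rightarrow> nat \<Rightarrow> (nat \<Rightarrow> 'w \<Rightarrow> 'a::real_inner) \<Rightarrow> bool" where
  "M_estimator_well_defined M \<psi> n X \<longleftrightarrow>
     (AE \<omega> in M. \<exists>!\<theta>. M_equation \<psi> n (\<lambda>i. X i \<omega>) \<theta>) \<and>
     (\<lambda>\<omega>. M_estimator \<psi> n (\<lambda>i. X i \<omega>)) \<in> borel_measurable M \<and>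
     (\<forall>\<theta>. (\<lambda>\<omega>. empirical_IF \<psi> n \<theta> (\<lambda>i. X i \<omega>)) \<in> borel_measurable M)"

definition iid_sample ::
  "'w measure \<Rightarrow> 'a::real_inner measure \<Rightarrow> nat \<Rightarrow> (nat \<Rightarrow> 'w \<Rightarrow> 'a) \<Rightarrow> bool" where
  "iid_sample M P n X \<longleftrightarrow>
     prob_space.indep_vars M (\<lambda>_. borel) X {1..n} \<and> (\<forall>i\<in>{1..n}. distr M borel (X i) = P)"

text \<open>
  The adversary sees the sample before choosing which points to modify, so the index set \<open>Out \<omega>\<close> of
  outliers is random; it need not be measurable.  A fixed outlier set is the constant case.
\<close>

definition adversarial_corruption ::
  "'w measure \<Rightarrow> nat \<Rightarrow> (nat \<Rightarrow> 'w \<Rightarrow> 'a::real_inner) \<Rightarrow> (nat \<Rightarrow> 'w \<Rightarrow> 'a) \<Rightarrow> ('w \<Rightarrow> nat set) \<Rightarrow> bool" where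
  "adversarial_corruption M n X' X Out \<longleftrightarrow>
     (\<forall>i\<in>{1..n}. X i \<in> borel_measurable M) \<and>
     (\<forall>\<omega>\<in>space M. Out \<omega> \<subseteq> {1..n} \<and> card (Out \<omega>) < card ({1..n} - Out \<omega>) \<and>
        (\<forall>i\<in>{1..n} - Out \<omega>. X i \<omega> = X' i \<omega>))"

text \<open>
  \<open>has_mean P m\<close> says that the identity is Bochner integrable under \<open>P\<close> with integral \<open>m\<close>.  It spells
  out the library's \<open>has_bochner_integral\<close> without the sort constraint \<open>second_countable_topology\<close>,
  so that the Hilbert space is not assumed to be separable.
\<close>

definition has_mean :: "'a::real_inner measure \<Rightarrow> 'a \<Rightarrow> bool" where
  "has_mean P m \<longleftrightarrow> (\<lambda>x. x) \<in> borel_measurable P \<and>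
     (\<exists>s. (\<forall>i. Bochner_Integration.simple_bochner_integrable P (s i)) \<and>
       (\<lambda>i. \<integral>\<^sup>+x. ennreal (norm (x - s i x)) \<partial>P) \<longlonglongrightarrow> 0 \<and>
       (\<lambda>i. Bochner_Integration.simple_bochner_integral P (s i)) \<longlonglongrightarrow> m)"

lemma has_mean_iff_has_bochner_integral:
  fixes P :: "'a::{real_inner, second_countable_topology} measure"
  shows "has_mean P m \<longleftrightarrow> has_bochner_integral P (\<lambda>x. x) m"
  unfolding has_mean_def has_bochner_integral.simps by blast

lemma empirical_IF_measurable:
  fixes X :: "nat \<Rightarrow> 'w \<Rightarrow> 'a::{real_inner, second_countable_topology}"
  assumes "score_function \<psi> \<beta> \<gamma>"
    and X: "\<And>i. i \<in> {1..n} \<Longrightarrow> X i \<in> borel_measurable M"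
  shows "(\<lambda>\<omega>. empirical_IF \<psi> n \<theta> (\<lambda>i. X i \<omega>)) \<in> borel_measurable M"
proof -
  have "continuous_on {0..} \<psi>"
    using assms(1) by (simp add: score_function_def)
  then have "continuous_on UNIV (\<lambda>t. \<psi> (max 0 t))"
    by (rule continuous_on_compose2) (auto intro!: continuous_intros)
  then have *: "(\<lambda>t. \<psi> (max 0 t)) \<in> borel_measurable borel"
    by (rule borel_measurable_continuous_onI)
  have "(\<lambda>\<omega>. score_vector \<psi> (X i \<omega>) \<theta>) \<in> borel_measurable M" if "i \<in> {1..n}" for i
  proof -
    note [measurable] = X[OF that]
    have "(\<lambda>\<omega>. \<psi> (max 0 (norm (X i \<omega> - \<theta>)))) \<in> borel_measurable M"
      by (rule measurable_compose[OF _ *]) measurable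
    then have [measurable]: "(\<lambda>\<omega>. \<psi> (norm (X i \<omega> - \<theta>))) \<in> borel_measurable M"
      by simp
    show ?thesis
      unfolding score_vector_def sgn_div_norm by measurable
  qed
  then show ?thesis
    unfolding empirical_IF_def by (intro borel_measurable_scaleR borel_measurable_sum) auto
qed

text \<open>
  The two moments below are integrals of nonnegative functions and are taken in \<open>ennreal\<close>, so an upper
  bound on them includes their finiteness.
\<close>

definition rho_moment :: "(real \<Rightarrow> real) \<Rightarrow> 'a::real_inner measure \<Rightarrow> 'a \<Rightarrow> ennreal" where
  "rho_moment \<psi> P m = (\<integral>\<^sup>+x. ennreal (rho \<psi> (norm (x - m))) \<partial>P)"

definition V_moment :: "(real \<Rightarrow> real) \<Rightarrow> 'a::real_inner measure \<Rightarrow> 'a \<Rightarrow> ennreal" where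
  "V_moment \<psi> P \<theta> = (\<integral>\<^sup>+x. ennreal ((\<psi> (norm (x - \<theta>)))\<^sup>2) \<partial>P)"

end

theory Submission
  imports Defs
begin

text \<open>
  The map \<open>\<theta> \<mapsto> - score_vector \<psi> x \<theta>\<close> is the gradient of the convex function
  \<open>\<theta> \<mapsto> \<rho>(\<parallel>x - \<theta>\<parallel>)\<close>, hence monotone, and it is strongly monotone with constant \<open>\<gamma>\<close> on the ball of
  radius \<open>\<beta>\<close> about \<open>x\<close>.  If the estimator lies at distance at least \<open>r < \<beta> / 2\<close> from \<open>\<theta>\<close>, move from
  \<open>\<theta>\<close> by \<open>r\<close> towards it: by monotonicity the radial component of the empirical influence function is
  still nonnegative there, while each of the sample points within
  \<open>\<beta> / 2\<close> of \<open>\<theta>\<close> has made it drop by at least \<open>\<gamma> r / n\<close> on the way.  By Markov's inequality an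
  inlier is that close with probability at least \<open>1 / 2\<close>; by Hoeffding's inequality with deviation
  \<open>n \<gamma> / 8\<close>, and after discarding at most \<open>n \<gamma> / 8\<close> outliers, at least
  \<open>n (1 / 2 - \<gamma> / 4) \<ge> n / 4\<close> such points remain outside an event of probability
  \<open>exp (- n \<gamma>\<^sup>2 / 32)\<close>.
\<close>

section \<open>Increments of the score function\<close>

lemma AE_lborel_obtains_between:
  fixes a b :: real
  assumes "AE x in lborel. Q x" and "a < b"
  obtains z where "a < z" "z < b" "Q z"
proof -
  obtain N where N: "{x. \<not> Q x} \<subseteq> N" "emeasure lborel N = 0" "N \<in> sets lborel"
    using AE_E[OF assms(1)] by auto
  have "\<not> {a<..<b} \<subseteq> N"
  proof
    assume "{a<..<b} \<subseteq> N"
    then have "emeasure lborel {a<..<b} \<le> emeasure lborel N"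
      using N(3) by (intro emeasure_mono) auto
    then show False
      using N(2) \<open>a < b\<close> by simp
  qed
  with N(1) show ?thesis
    using that by force
qed

text \<open>The derivative bounds are available only where the derivative exists. Almost every point
  qualifies and no nonempty open interval is a null set, so a suitable \<open>z\<close> can be found
  as close to the right of \<open>y\<close> as desired.\<close>

lemma score_function_deriv_between:
  assumes sf: "score_function \<psi> \<beta> \<gamma>" and "0 \<le> y" "y < b"
  obtains z D where "y < z" "z < b" "(\<psi> has_real_derivative D) (at z within {0..})"
    "\<gamma> * indicator {..\<beta>} z \<le> D" "D \<le> 1"
proof -
  have "AE x in lborel. 0 \<le> x \<longrightarrow> \<psi> differentiable (at x within {0..})"
    using sf by (simp add: score_function_def)
  from this \<open>y < b\<close> obtain z where z: "y < z" "z < b" "0 \<le> z \<longrightarrow> \<psi> differentiable (at z within {0..})"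
    by (rule AE_lborel_obtains_between)
  with \<open>0 \<le> y\<close> obtain D where D: "(\<psi> has_real_derivative D) (at z within {0..})"
    by (auto simp: real_differentiable_def)
  have "\<gamma> * indicator {..\<beta>} z \<le> D \<and> D \<le> 1"
    using sf D order_trans[OF \<open>0 \<le> y\<close> less_imp_le[OF z(1)]]
    unfolding score_function_def by blast
  with z D that show ?thesis by blast
qed

text \<open>
  By concavity the slope over \<open>[x, y]\<close> exceeds the derivative at any point of differentiability to
  the right of \<open>y\<close>.
\<close>

lemma score_function_diff_ge:
  assumes sf: "score_function \<psi> \<beta> \<gamma>" and "0 \<le> x" "x \<le> y" "y < b"
    and c: "\<And>z. y < z \<Longrightarrow> z < b \<Longrightarrow> c \<le> \<gamma> * indicator {..\<beta>} z"
  shows "c * (y - x) \<le> \<psi> y - \<psi> x"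
proof (cases "x = y")
  case False
  with assms have xy: "x < y" "0 \<le> y" by auto
  obtain z D where z: "y < z" "z < b" and D: "(\<psi> has_real_derivative D) (at z within {0..})"
    and "\<gamma> * indicator {..\<beta>} z \<le> D"
    using score_function_deriv_between[OF sf \<open>0 \<le> y\<close> \<open>y < b\<close>] by blast
  with c[OF z] have cD: "c \<le> D" by linarith
  have cvx: "convex_on {0..} (\<lambda>t. - \<psi> t)"
    using sf by (simp add: score_function_def concave_on_def)
  have "((\<lambda>t. - \<psi> t) has_real_derivative - D) (at z within {0..})"
    using D by (rule DERIV_minus)
  then have tangent: "- \<psi> y - - \<psi> z \<ge> - D * (y - z)"
    using z xy by (intro convex_on_imp_above_tangent[OF cvx]) auto
  then have "D * (z - y) \<le> \<psi> z - \<psi> y"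
    by (simp add: algebra_simps)
  then have "D \<le> (\<psi> z - \<psi> y) / (z - y)"
    using z by (simp add: field_simps)
  also have "\<dots> \<le> (\<psi> y - \<psi> x) / (y - x)"
    using convex_on_slope_le[OF cvx, of x z y] z xy \<open>0 \<le> x\<close>
    by (simp add: field_simps)
  finally have "c \<le> (\<psi> y - \<psi> x) / (y - x)"
    using cD by linarith
  then show ?thesis
    using xy by (simp add: field_simps)
qed simp

lemma score_function_mono:
  assumes "score_function \<psi> \<beta> \<gamma>" "0 \<le> x" "x \<le> y"
  shows "\<psi> x \<le> \<psi> y"
  \<comment> \<open>With slope bound \<open>0\<close> the indicator condition holds everywhere, so
    any endpoint beyond \<open>y\<close> serves.\<close>
  using score_function_diff_ge[OF assms, of "y + 1" 0] assms(1)
  by (simp add: score_function_def)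

text \<open>The strict bound \<open>y < \<beta>\<close> leaves room for a point of differentiability
  between \<open>y\<close> and \<open>\<beta>\<close>, where the indicator equals 1.\<close>

lemma score_function_strong_mono:
  assumes "score_function \<psi> \<beta> \<gamma>" "0 \<le> x" "x \<le> y" "y < \<beta>"
  shows "\<gamma> * (y - x) \<le> \<psi> y - \<psi> x"
  using score_function_diff_ge[OF assms, of \<gamma>] by simp

lemma score_function_le_one:
  assumes sf: "score_function \<psi> \<beta> \<gamma>"
  shows "\<gamma> \<le> 1"
proof -
  have "0 < \<beta>" using sf by (simp add: score_function_def)
  then obtain z D where "z < \<beta>" "\<gamma> * indicator {..\<beta>} z \<le> D" "D \<le> 1"
    using score_function_deriv_between[OF sf order_refl, of \<beta>] by metis
  then show ?thesis by simp
qed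

section \<open>Monotonicity of radial vector fields\<close>

text \<open>The inner product exceeds
  \<open>(\<phi> (norm v) - \<phi> (norm w)) * (norm v - norm w)\<close> by
  \<open>\<phi> (norm v) * (norm w - inner (sgn v) w)\<close> plus its mirror image, both
  nonnegative by Cauchy-Schwarz. The radius \<open>R\<close> admits profiles that increase only on a
  bounded interval.\<close>

lemma radial_field_monotone:
  fixes v w :: "'a::real_inner"
  assumes mono: "\<And>a b. 0 \<le> a \<Longrightarrow> a \<le> b \<Longrightarrow> b \<le> R \<Longrightarrow> \<phi> a \<le> \<phi> b"
    and "0 \<le> \<phi> 0" and v: "norm v \<le> R" and w: "norm w \<le> R"
  shows "0 \<le> inner (\<phi> (norm v) *\<^sub>R sgn v - \<phi> (norm w) *\<^sub>R sgn w) (v - w)"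
proof -
  have nonneg: "0 \<le> \<phi> (norm v)" "0 \<le> \<phi> (norm w)"
    using mono[of 0 "norm v"] mono[of 0 "norm w"] assms(2-) by force+
  have self: "inner (sgn u) u = norm u" for u :: 'a
    by (cases "u = 0") (simp_all add: sgn_div_norm power2_norm_eq_inner[symmetric] power2_eq_square)
  have cross: "inner (sgn u) u' \<le> norm u'" for u u' :: 'a
    using norm_cauchy_schwarz[of "sgn u" u'] by (cases "u = 0") (auto simp: norm_sgn)
  have "0 \<le> (\<phi> (norm v) - \<phi> (norm w)) * (norm v - norm w)"
    using mono[of "norm v" "norm w"] mono[of "norm w" "norm v"] v w
    by (cases "norm v \<le> norm w") (auto intro!: mult_nonneg_nonneg mult_nonpos_nonpos)
  also have "\<dots> \<le> inner (\<phi> (norm v) *\<^sub>R sgn v - \<phi> (norm w) *\<^sub>R sgn w) (v - w)"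
    using mult_left_mono[OF cross[of v w] nonneg(1)] mult_left_mono[OF cross[of w v] nonneg(2)]
    by (simp add: inner_diff_left inner_diff_right self algebra_simps)
  finally show ?thesis .
qed

lemma score_vector_monotone:
  fixes x u w :: "'a::real_inner"
  assumes sf: "score_function \<psi> \<beta> \<gamma>"
  shows "0 \<le> inner (score_vector \<psi> x u - score_vector \<psi> x w) (w - u)"
  using radial_field_monotone[of "max (norm (x - u)) (norm (x - w))" \<psi> "x - u" "x - w"]
    score_function_mono[OF sf] sf
  by (simp add: score_vector_def score_function_def)

lemma score_vector_strongly_monotone:
  fixes x u w :: "'a::real_inner"
  assumes sf: "score_function \<psi> \<beta> \<gamma>"
    and u: "norm (x - u) < \<beta>" and w: "norm (x - w) < \<beta>"
  shows "\<gamma> * (norm (w - u))\<^sup>2 \<le> inner (score_vector \<psi> x u - score_vector \<psi> x w) (w - u)"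
proof -
  \<comment> \<open>This profile is still nondecreasing below \<open>\<beta>\<close>, and its radial
    field is that of \<open>\<psi>\<close> minus \<open>\<gamma>\<close> times the identity; plain
    monotonicity of the difference is strong monotonicity of the original.\<close>
  let ?\<phi> = "\<lambda>t. \<psi> t - \<gamma> * t"
  have "0 \<le> inner (?\<phi> (norm (x - u)) *\<^sub>R sgn (x - u) - ?\<phi> (norm (x - w)) *\<^sub>R sgn (x - w)) (x - u - (x - w))"
  proof (rule radial_field_monotone[where R = "max (norm (x - u)) (norm (x - w))"])
    show "?\<phi> a \<le> ?\<phi> b" if "0 \<le> a" "a \<le> b" "b \<le> max (norm (x - u)) (norm (x - w))" for a b
      using score_function_strong_mono[OF sf that(1,2)] that u w by (simp add: algebra_simps)
  qed (use sf in \<open>auto simp: score_function_def\<close>)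
  moreover have "?\<phi> (norm y) *\<^sub>R sgn y = \<psi> (norm y) *\<^sub>R sgn y - \<gamma> *\<^sub>R y" for y :: 'a
    by (cases "y = 0") (simp_all add: sgn_div_norm left_diff_distrib scaleR_diff_left)
  moreover have "(p - \<gamma> *\<^sub>R (x - u)) - (q - \<gamma> *\<^sub>R (x - w)) = (p - q) - \<gamma> *\<^sub>R (w - u)" for p q :: 'a
    by (simp add: scaleR_diff_right)
  ultimately have "0 \<le> inner ((score_vector \<psi> x u - score_vector \<psi> x w) - \<gamma> *\<^sub>R (w - u)) (w - u)"
    by (simp add: score_vector_def)
  then show ?thesis
    by (simp add: inner_diff_left[of _ "\<gamma> *\<^sub>R (w - u)"] power2_norm_eq_inner)
qed

section \<open>Deterministic lower bound on the empirical influence function\<close>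

lemma empirical_IF_ge_of_M_equation:
  fixes x :: "nat \<Rightarrow> 'a::real_inner"
  assumes sf: "score_function \<psi> \<beta> \<gamma>"
    and zero: "M_equation \<psi> n x \<tau>"
    and r: "0 < r" "r < \<beta> / 2" "r \<le> norm (\<tau> - \<theta>)"
    and G: "G \<subseteq> {1..n}" "\<And>i. i \<in> G \<Longrightarrow> norm (x i - \<theta>) \<le> \<beta> / 2"
    and card: "real n / 4 \<le> card G" and "0 < n"
  shows "r * \<gamma> / 4 \<le> norm (empirical_IF \<psi> n \<theta> x)"
proof -
  define S where "S u = (\<Sum>i=1..n. score_vector \<psi> (x i) u)" for u
  define s where "s = r / norm (\<tau> - \<theta>)"
  \<comment> \<open>The point of the segment from \<open>\<theta>\<close> to \<open>\<tau>\<close>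
    at distance \<open>r\<close> from \<open>\<theta>\<close>.\<close>
  define u where "u = \<theta> + s *\<^sub>R (\<tau> - \<theta>)"
  have \<gamma>: "0 < \<gamma>" using sf by (simp add: score_function_def)
  have pos: "0 < norm (\<tau> - \<theta>)" using r by linarith
  have s: "0 < s" "s \<le> 1" unfolding s_def using r pos by (simp_all only: divide_pos_pos divide_le_eq_1_pos)
  have u\<theta>: "u - \<theta> = s *\<^sub>R (\<tau> - \<theta>)" by (simp add: u_def)
  have \<tau>u: "\<tau> - u = (1 - s) *\<^sub>R (\<tau> - \<theta>)" by (simp add: u_def algebra_simps)
  have norm_u: "norm (u - \<theta>) = r" using r pos by (auto simp: u\<theta> s_def)
  have [simp]: "S \<tau> = 0" using zero by (simp add: S_def M_equation_def)
  have "0 \<le> inner (S u - S \<tau>) (\<tau> - u)"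
    unfolding S_def sum_subtractf[symmetric] inner_sum_left
    by (intro sum_nonneg score_vector_monotone[OF sf])
  \<comment> \<open>Both \<open>\<tau> - u\<close> and \<open>u - \<theta>\<close> are nonnegative
    multiples of \<open>\<tau> - \<theta>\<close>, so the sign carries over. For
    \<open>s = 1\<close> the first one vanishes, but then \<open>u = \<tau>\<close> and
    \<open>S u = 0\<close>.\<close>
  then have Su: "0 \<le> inner (S u) (u - \<theta>)"
  proof (cases "s = 1")
    case True
    then show ?thesis by (simp add: u_def)
  next
    case False
    then show ?thesis
      using \<open>0 \<le> inner (S u - S \<tau>) (\<tau> - u)\<close> s
      by (simp add: \<tau>u u\<theta> zero_le_mult_iff)
  qed
  have "real (card G) * (\<gamma> * r\<^sup>2) = (\<Sum>i\<in>G. \<gamma> * (norm (u - \<theta>))\<^sup>2)"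
    by (simp add: norm_u)
  also have "\<dots> \<le> (\<Sum>i\<in>G. inner (score_vector \<psi> (x i) \<theta> - score_vector \<psi> (x i) u) (u - \<theta>))"
  proof (rule sum_mono)
    fix i assume "i \<in> G"
    then have "norm (x i - \<theta>) \<le> \<beta> / 2" by (rule G)
    \<comment> \<open>As \<open>r < \<beta> / 2\<close>, both \<open>\<theta>\<close> and
      \<open>u\<close> lie within \<open>\<beta>\<close> of \<open>x i\<close>, the range of strong
      monotonicity.\<close>
    moreover have "norm (x i - u) \<le> norm (x i - \<theta>) + norm (u - \<theta>)"
      using norm_triangle_ineq4[of "x i - \<theta>" "u - \<theta>"] by simp
    ultimately show "\<gamma> * (norm (u - \<theta>))\<^sup>2
        \<le> inner (score_vector \<psi> (x i) \<theta> - score_vector \<psi> (x i) u) (u - \<theta>)"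
      using r norm_u by (intro score_vector_strongly_monotone[OF sf]) linarith+
  qed
  \<comment> \<open>The remaining points, outliers included, contribute nonnegative terms by
    monotonicity, wherever they are.\<close>
  also have "\<dots> \<le> (\<Sum>i=1..n. inner (score_vector \<psi> (x i) \<theta> - score_vector \<psi> (x i) u) (u - \<theta>))"
    using G(1) by (intro sum_mono2 score_vector_monotone[OF sf]) auto
  also have "\<dots> = inner (S \<theta> - S u) (u - \<theta>)"
    by (simp add: S_def sum_subtractf inner_sum_left inner_diff_left)
  also have "\<dots> \<le> inner (S \<theta>) (u - \<theta>)"
    using Su by (simp add: inner_diff_left)
  also have "\<dots> \<le> norm (S \<theta>) * r"
    using norm_cauchy_schwarz[of "S \<theta>" "u - \<theta>"] by (simp add: norm_u)
  finally have "real (card G) * \<gamma> * r \<le> norm (S \<theta>)"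
    using r(1) by (simp add: power2_eq_square)
  moreover have "real n / 4 * (\<gamma> * r) \<le> real (card G) * (\<gamma> * r)"
    using card \<gamma> r(1) by (intro mult_right_mono) auto
  ultimately have "real n / 4 * (\<gamma> * r) \<le> norm (S \<theta>)"
    by simp
  then show ?thesis
    using \<open>0 < n\<close> by (simp add: empirical_IF_def S_def[unfolded One_nat_def, symmetric] field_simps)
qed

section \<open>Counting sample points near the centre\<close>

lemma prob_near_ge_half:
  fixes P :: "'a::real_inner measure"
  assumes "prob_space P" and sets: "sets P = sets borel" and sf: "score_function \<psi> \<beta> \<gamma>"
    and V: "V_moment \<psi> P \<theta> \<le> ennreal ((\<psi> (\<beta> / 2))\<^sup>2 / 2)"
  shows "1 / 2 \<le> measure P (cball \<theta> (\<beta> / 2))"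
proof -
  interpret prob_space P by fact
  have pos: "0 < \<beta>" "0 < \<gamma>" and "\<psi> 0 = 0"
    using sf by (auto simp: score_function_def)
  \<comment> \<open>Strong monotonicity from 0 gives
    \<open>\<psi> (\<beta> / 2) \<ge> \<gamma> * \<beta> / 2\<close>; positivity allows cancelling
    this factor after Markov's inequality.\<close>
  then have p: "0 < \<psi> (\<beta> / 2)"
    using less_le_trans[OF mult_pos_pos[of \<gamma> "\<beta> / 2"], of "\<psi> (\<beta> / 2)"]
      score_function_strong_mono[OF sf, of 0 "\<beta> / 2"] by simp
  let ?B = "cball \<theta> (\<beta> / 2)"
  have space: "space P = UNIV"
    using sets_eq_imp_space_eq[OF sets] by simp
  have B: "?B \<in> sets P" "- ?B \<in> sets P"
    using sets by auto
  have "ennreal ((\<psi> (\<beta> / 2))\<^sup>2) * emeasure P (- ?B)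
      = (\<integral>\<^sup>+x. ennreal ((\<psi> (\<beta> / 2))\<^sup>2) * indicator (- ?B) x \<partial>P)"
    using B by (simp add: nn_integral_cmult_indicator)
  also have "\<dots> \<le> V_moment \<psi> P \<theta>"
    unfolding V_moment_def
  proof (rule nn_integral_mono)
    fix x
    show "ennreal ((\<psi> (\<beta> / 2))\<^sup>2) * indicator (- ?B) x \<le> ennreal ((\<psi> (norm (x - \<theta>)))\<^sup>2)"
    proof (cases "x \<in> ?B")
      case False
      then have "\<beta> / 2 \<le> norm (x - \<theta>)"
        by (simp add: dist_norm norm_minus_commute)
      then have "\<psi> (\<beta> / 2) \<le> \<psi> (norm (x - \<theta>))"
        using pos by (intro score_function_mono[OF sf]) auto
      then show ?thesis
        using False p by (auto intro!: ennreal_leI power_mono)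
    qed simp
  qed
  also note V
  finally have "ennreal ((\<psi> (\<beta> / 2))\<^sup>2 * measure P (- ?B)) \<le> ennreal ((\<psi> (\<beta> / 2))\<^sup>2 / 2)"
    by (simp add: emeasure_eq_measure ennreal_mult)
  then have "measure P (- ?B) \<le> 1 / 2"
    using p by (simp add: field_simps)
  then show ?thesis
    using prob_compl[OF B(1)] by (simp add: space Compl_eq_Diff_UNIV)
qed

lemma iid_sample_few_near:
  fixes P :: "'a::real_inner measure"
  assumes "prob_space M" and iid: "iid_sample M P n X"
    and B: "B \<in> sets borel" "1 / 2 \<le> measure P B" and "0 \<le> \<epsilon>" "0 < n"
  shows "{\<omega> \<in> space M. real (card {i \<in> {1..n}. X i \<omega> \<in> B}) \<le> n * (1 / 2 - \<epsilon>)} \<in> sets M" (is "?E \<in> _")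
    and "measure M {\<omega> \<in> space M. real (card {i \<in> {1..n}. X i \<omega> \<in> B}) \<le> n * (1 / 2 - \<epsilon>)}
      \<le> exp (- (2 * real n * \<epsilon>\<^sup>2))"
proof -
  interpret prob_space M by fact
  define Y where "Y i \<omega> = (indicator B (X i \<omega>) :: real)" for i \<omega>
  have indep: "indep_vars (\<lambda>_. borel) X {1..n}"
    and distr: "\<And>i. i \<in> {1..n} \<Longrightarrow> distr M borel (X i) = P"
    using iid by (auto simp: iid_sample_def)
  have X: "X i \<in> borel_measurable M" if "i \<in> {1..n}" for i
    using indep that by (auto simp: indep_vars_def)
  have ind: "(indicator B :: 'a \<Rightarrow> real) \<in> borel_measurable borel"
    using B(1) by (intro borel_measurable_indicator)
  have Y: "Y i \<in> borel_measurable M" if "i \<in> {1..n}" for i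
    unfolding Y_def by (rule measurable_compose[OF X[OF that] ind])
  have indepY: "indep_vars (\<lambda>_. borel) Y {1..n}"
    unfolding Y_def using ind by (intro indep_vars_compose2[OF indep])
  interpret Hoeffding_ineq M "{1..n}" Y "\<lambda>_. 0" "\<lambda>_. 1" "\<Sum>i=1..n. expectation (Y i)"
  proof unfold_locales
    show "AE \<omega> in M. Y i \<omega> \<in> {0..1}" for i
      by (simp add: Y_def)
  qed (use indepY in simp_all)
  have card: "real (card {i \<in> {1..n}. X i \<omega> \<in> B}) = (\<Sum>i=1..n. Y i \<omega>)" for \<omega>
    by (simp add: Y_def indicator_def sum.If_cases Int_def)
  have "1 / 2 \<le> expectation (Y i)" if i: "i \<in> {1..n}" for i
  proof -
    have "expectation (Y i) = integral\<^sup>L (distr M borel (X i)) (indicator B)"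
      unfolding Y_def by (rule integral_distr[symmetric, OF X[OF i] ind])
    also have "\<dots> = measure P (B \<inter> space P)"
      by (simp add: distr[OF i])
    also have "B \<inter> space P = B"
      using distr[OF i] by (metis Int_UNIV_right space_borel space_distr)
    finally show ?thesis using B(2) by simp
  qed
  then have "real (card {1..n}) * (1 / 2) \<le> (\<Sum>i=1..n. expectation (Y i))"
    by (intro sum_bounded_below) auto
  \<comment> \<open>The expected count is at least \<open>n / 2\<close>, so \<open>?E\<close> lies
    in the event of falling \<open>n * \<epsilon>\<close> below the mean.\<close>
  then have \<mu>: "n * (1 / 2 - \<epsilon>) \<le> (\<Sum>i=1..n. expectation (Y i)) - n * \<epsilon>"
    by (simp add: algebra_simps)
  have meas: "(\<lambda>\<omega>. \<Sum>i=1..n. Y i \<omega>) \<in> borel_measurable M"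
    using Y by (intro borel_measurable_sum) auto
  then show "?E \<in> sets M"
    unfolding card by measurable
  have "measure M ?E \<le> prob {\<omega> \<in> space M. (\<Sum>i=1..n. Y i \<omega>) \<le> (\<Sum>i=1..n. expectation (Y i)) - n * \<epsilon>}"
    unfolding card using \<mu> meas by (intro finite_measure_mono) auto
  also have "\<dots> \<le> exp (- 2 * (n * \<epsilon>)\<^sup>2 / (\<Sum>i=1..n. (1 - 0)\<^sup>2))"
    using \<open>0 \<le> \<epsilon>\<close> \<open>0 < n\<close> by (intro Hoeffding_ineq_le) auto
  also have "- 2 * (n * \<epsilon>)\<^sup>2 / (\<Sum>i=1..n. (1 - 0)\<^sup>2) = - (2 * real n * \<epsilon>\<^sup>2)"
    using \<open>0 < n\<close> by (simp add: power2_eq_square)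
  finally show "measure M ?E \<le> exp (- (2 * real n * \<epsilon>\<^sup>2))" .
qed

section \<open>The tail comparison\<close>

theorem theorem1:
  fixes M :: "'w measure"
    and P :: "'a::{real_inner, complete_space} measure"
    and X' X :: "nat \<Rightarrow> 'w \<Rightarrow> 'a"
    and Out :: "'w \<Rightarrow> nat set"
    and \<psi> :: "real \<Rightarrow> real"
    and \<beta> \<gamma> :: real
    and n :: nat
    and m :: 'a
  assumes "prob_space M"
    and "prob_space P" and "sets P = sets borel"
    and "score_function \<psi> \<beta> \<gamma>"
    and "iid_sample M P n X'"
    and "adversarial_corruption M n X' X Out"
    and "M_estimator_well_defined M \<psi> n X"
    and "has_mean P m"
    and "rho_moment \<psi> P m < ennreal (min (rho \<psi> (\<beta> / 3)) ((\<psi> (\<beta> / 2))\<^sup>2 / 2))"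
    and "\<forall>\<omega>\<in>space M. real (card (Out \<omega>)) \<le> real n * \<gamma> / 8"
  shows "\<forall>r\<in>{0<..<\<beta> / 2}. \<forall>\<theta>. V_moment \<psi> P \<theta> \<le> ennreal ((\<psi> (\<beta> / 2))\<^sup>2 / 2) \<longrightarrow>
           tail_T M \<psi> n X \<theta> r \<le> tail_IF M \<psi> n X \<theta> (r * \<gamma> / 4) + exp (- (real n * \<gamma>\<^sup>2 / 32))"
proof (intro ballI allI impI)
  fix r \<theta>
  assume r: "r \<in> {0<..<\<beta> / 2}" and V: "V_moment \<psi> P \<theta> \<le> ennreal ((\<psi> (\<beta> / 2))\<^sup>2 / 2)"
  interpret prob_space M by fact
  note sf = \<open>score_function \<psi> \<beta> \<gamma>\<close>
  show "tail_T M \<psi> n X \<theta> r \<le> tail_IF M \<psi> n X \<theta> (r * \<gamma> / 4) + exp (- (real n * \<gamma>\<^sup>2 / 32))"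
  \<comment> \<open>For the empty sample the exponential equals 1 and dominates any
    probability.\<close>
  proof (cases "n = 0")
    case True
    then show ?thesis
      unfolding tail_T_def tail_IF_def by (simp add: add_increasing)
  next
    case False
    then have "0 < n" by simp
    have \<gamma>: "0 < \<gamma>" "\<gamma> \<le> 1"
      using sf score_function_le_one[OF sf] by (auto simp: score_function_def)
    let ?near = "\<lambda>\<omega>. {i \<in> {1..n}. X' i \<omega> \<in> cball \<theta> (\<beta> / 2)}"
    let ?E = "{\<omega> \<in> space M. real (card (?near \<omega>)) \<le> n * (1 / 2 - \<gamma> / 8)}"
    let ?F = "{\<omega> \<in> space M. norm (empirical_IF \<psi> n \<theta> (\<lambda>i. X i \<omega>)) \<ge> r * \<gamma> / 4}"
    have "1 / 2 \<le> measure P (cball \<theta> (\<beta> / 2))"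
      using prob_near_ge_half[OF assms(2,3) sf V] .
    \<comment> \<open>The count concerns the clean sample \<open>X'\<close>, which is independent.
      Deviation \<open>\<gamma> / 8\<close> matches the allowed fraction of outliers and yields the
      exponent \<open>2 * n * (\<gamma> / 8)\<^sup>2 = n * \<gamma>\<^sup>2 / 32\<close>.\<close>
    note E = iid_sample_few_near[OF assms(1,5) _ this, of "\<gamma> / 8"]
    have E_sets: "?E \<in> sets M"
      using \<gamma> \<open>0 < n\<close> by (intro E(1)) auto
    have "measure M ?E \<le> exp (- (2 * real n * (\<gamma> / 8)\<^sup>2))"
      using \<gamma> \<open>0 < n\<close> by (intro E(2)) auto
    also have "\<dots> = exp (- (real n * \<gamma>\<^sup>2 / 32))"
      by (simp add: power_divide)
    finally have E_prob: "measure M ?E \<le> exp (- (real n * \<gamma>\<^sup>2 / 32))" .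
    have uniq: "AE \<omega> in M. \<exists>!\<theta>. M_equation \<psi> n (\<lambda>i. X i \<omega>) \<theta>"
      and IF: "(\<lambda>\<omega>. empirical_IF \<psi> n \<theta> (\<lambda>i. X i \<omega>)) \<in> borel_measurable M"
      using assms(7) by (auto simp: M_estimator_well_defined_def)
    have F_sets: "?F \<in> sets M"
      using IF by measurable
    \<comment> \<open>The inclusion is only almost sure, because \<open>THE\<close> is known to
      solve the equation only where the solution is unique. Arguing for each \<open>\<omega>\<close>
      separately accommodates an outlier set that depends on the sample.\<close>
    have "AE \<omega> in M. norm (M_estimator \<psi> n (\<lambda>i. X i \<omega>) - \<theta>) \<ge> r \<longrightarrow> \<omega> \<in> ?F \<union> ?E"
      using uniq AE_space
    proof eventually_elim
      case (elim \<omega>)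
      show ?case
      proof (intro impI UnCI)
        assume far: "r \<le> norm (M_estimator \<psi> n (\<lambda>i. X i \<omega>) - \<theta>)" and "\<omega> \<notin> ?E"
        then have near: "n * (1 / 2 - \<gamma> / 8) < card (?near \<omega>)"
          using elim by auto
        let ?G = "?near \<omega> - Out \<omega>"
        have Out: "finite (Out \<omega>)" "real (card (Out \<omega>)) \<le> n * \<gamma> / 8"
          "\<And>i. i \<in> {1..n} - Out \<omega> \<Longrightarrow> X i \<omega> = X' i \<omega>"
          using assms(6,10) elim finite_subset[of "Out \<omega>" "{1..n}"]
          by (auto simp: adversarial_corruption_def)
        have "card (?near \<omega>) \<le> card ?G + card (Out \<omega>)"
          using diff_card_le_card_Diff[OF Out(1), of "?near \<omega>"] by linarith
        then have "n * (1 / 2 - \<gamma> / 4) \<le> card ?G"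
          using near Out(2) by (simp add: algebra_simps)
        \<comment> \<open>This is where \<open>\<gamma> \<le> 1\<close> enters.\<close>
        moreover have "real n / 4 \<le> n * (1 / 2 - \<gamma> / 4)"
          using \<gamma> mult_left_mono[of "1 / 4" "1 / 2 - \<gamma> / 4" "real n"] by simp
        ultimately have "real n / 4 \<le> card ?G" by linarith
        moreover have "M_equation \<psi> n (\<lambda>i. X i \<omega>) (M_estimator \<psi> n (\<lambda>i. X i \<omega>))"
          unfolding M_estimator_def using elim(1) by (rule theI')
        moreover have "norm (X i \<omega> - \<theta>) \<le> \<beta> / 2" if "i \<in> ?G" for i
          using that Out(3)[of i] by (simp add: dist_norm norm_minus_commute)
        ultimately have "r * \<gamma> / 4 \<le> norm (empirical_IF \<psi> n \<theta> (\<lambda>i. X i \<omega>))"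
          using r far \<open>0 < n\<close> by (intro empirical_IF_ge_of_M_equation[OF sf, where G = ?G]) auto
        then show "\<omega> \<in> ?F" using elim by simp
      qed
    qed
    then have "AE \<omega> in M. \<omega> \<in> {\<omega> \<in> space M. norm (M_estimator \<psi> n (\<lambda>i. X i \<omega>) - \<theta>) \<ge> r}
        \<longrightarrow> \<omega> \<in> ?F \<union> ?E"
      by (rule AE_mp) (intro AE_I2, blast)
    then have "tail_T M \<psi> n X \<theta> r \<le> measure M (?F \<union> ?E)"
      unfolding tail_T_def using sets.Un[OF F_sets E_sets] by (rule finite_measure_mono_AE)
    also have "\<dots> \<le> measure M ?F + measure M ?E"
      using F_sets E_sets by (rule measure_Un_le)
    finally show ?thesis
      using E_prob unfolding tail_IF_def by linarith
  qed
qed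

end
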